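(* Let $m\geq 2$ be an integer and let $p>3$ be a prime with $p\neq m$. Then $$\mathcal{H}_{p,m}(p-1)\equiv-\frac{\mathcal{T}^*_{p,m}(2p)+2}{4p}-\frac{p}{2}\sum_{\substack{1\leq r\leq m\\ 2r\not\equiv p\pmod m}}\mathcal{H}_{r,m}(p-1)^2\pmod{p^2}.$$
   Context: For integers $r$, $m\geq 1$, $n\geq 0$ define $\mathcal{H}_{r,m}(n)=\sum_{1\leq k\leq n,\ k\equiv r \pmod m}\frac{1}{k}$ and $\mathcal{T}^*_{r,m}(n)=\sum_{0\leq k\leq n,\ k\equiv r\pmod m}(-1)^k\binom{n}{k}$. For rational numbers $a,b$ and a prime $p$, $a\equiv b\pmod{p^2}$ means that $(a-b)/p^2$, written in lowest terms, has denominator not divisible by $p$. *)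

theory Defs
  imports Complex_Main "HOL-Number_Theory.Cong" "HOL-Computational_Algebra.Primes"
begin

definition H_res :: "int \<Rightarrow> nat \<Rightarrow> nat \<Rightarrow> rat" where
  "H_res r m n = (\<Sum>k \<in> {k. 1 \<le> k \<and> k \<le> n \<and> [int k = r] (mod int m)}. 1 / of_nat k)"

definition T_star :: "int \<Rightarrow> nat \<Rightarrow> nat \<Rightarrow> int" where
  "T_star r m n =
     (\<Sum>k \<in> {k. k \<le> n \<and> [int k = r] (mod int m)}. (-1) ^ k * int (n choose k))"

text \<open>Since \<^const>\<open>quotient_of\<close> returns numerator and denominator in lowest terms, this is
  congruence of rationals modulo \<open>p\<^sup>2\<close>; neither side is required to be \<open>p\<close>-integral.\<close>

definition rat_cong_sq :: "nat \<Rightarrow> rat \<Rightarrow> rat \<Rightarrow> bool" where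
  "rat_cong_sq p a b \<longleftrightarrow> \<not> int p dvd snd (quotient_of ((a - b) / (of_nat p)\<^sup>2))"

end

theory Submission
  imports Defs
begin

text \<open>
  Reflecting \<open>k \<mapsto> 2p - k\<close> folds the sum \<open>T\<close> onto the indices below \<open>p\<close>, apart from the middle term
  \<open>-C(2p, p)\<close>, which is \<open>-2\<close> modulo \<open>p\<^sup>3\<close> by Wolstenholme. Since
  \<open>C(2p, k) = (2p / k) C(2p - 1, k - 1)\<close> and \<open>(-1)\<^sup>k C(2p - 1, k) \<equiv> 1 - 2p h(k)\<close> modulo \<open>p\<^sup>2\<close>, with
  \<open>h(k)\<close> the harmonic number, the claim reduces to
  \<open>\<Sum>\<^sub>r H\<^sub>r\<^sup>2 \<equiv> -4 \<Sum> h(s - 1) / s\<close> modulo \<open>p\<close>, where \<open>s < p\<close> runs through \<open>s \<equiv> p\<close> modulo \<open>m\<close>.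
  The classes with \<open>2r \<equiv> p\<close> may be added because reflection \<open>k \<mapsto> p - k\<close> gives \<open>H\<^sub>r \<equiv> 0\<close>.
  The left side is the sum of \<open>1 / (j k)\<close> over \<open>j \<equiv> k\<close>, which the substitution \<open>j \<mapsto> p - j\<close> turns
  into minus the sum over \<open>j + k \<equiv> p\<close>. There the pairs with \<open>j + k < p\<close> and those with \<open>j + k > p\<close>
  contribute \<open>2 \<Sum> h(s - 1) / s\<close> each, by \<open>1 / (j k) = (1 / j + 1 / k) / (j + k)\<close>, and the pairs with
  \<open>j + k = p\<close> contribute nothing.
\<close>

section \<open>Rationals integral at p, and congruence modulo powers of p\<close>

locale prime_modulus =
  fixes p :: nat
  assumes prime_p: "prime p"
begin

text \<open>The localization of the integers at p. Any representing fraction may serve as witness,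
  not only the reduced one, so closure under sums and products follows directly from p being
  prime.\<close>

definition integral :: "rat \<Rightarrow> bool" where
  "integral x \<longleftrightarrow> (\<exists>a b. \<not> int p dvd b \<and> x = of_int a / of_int b)"

text \<open>Congruence modulo p^n in the localization. It constrains only the difference, so
  \<open>x\<close> and \<open>y\<close> themselves may be non-integral; this is why the product
  rules below ask for integrality.\<close>

definition rcong :: "nat \<Rightarrow> rat \<Rightarrow> rat \<Rightarrow> bool" where
  "rcong n x y \<longleftrightarrow> (\<exists>z. integral z \<and> x - y = of_nat p ^ n * z)"

lemma prime_int_p: "prime (int p)"
  using prime_p by simp

lemma p_nonzero: "(of_nat p :: rat) \<noteq> 0"
  using prime_gt_0_nat[OF prime_p] by simp

lemma integral_divide_int:
  assumes "\<not> int p dvd b"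
  shows "integral (of_int a / of_int b)"
  using assms unfolding integral_def by blast

lemma integral_of_int [simp]: "integral (of_int a)"
  using integral_divide_int[of 1 a] prime_gt_1_nat[OF prime_p] by simp

lemma integral_of_nat [simp]: "integral (of_nat a)"
  using integral_of_int[of "int a"] by simp

lemma integral_0 [simp]: "integral 0"
  using integral_of_int[of 0] by simp

lemma integral_1 [simp]: "integral 1"
  using integral_of_int[of 1] by simp

lemma integral_add:
  assumes "integral x" "integral y"
  shows "integral (x + y)"
proof -
  obtain a b c d where "\<not> int p dvd b" "x = of_int a / of_int b"
    and "\<not> int p dvd d" "y = of_int c / of_int d"
    using assms unfolding integral_def by blast
  moreover from this have "b \<noteq> 0" "d \<noteq> 0"
    by auto
  ultimately have "\<not> int p dvd b * d" "x + y = of_int (a * d + c * b) / of_int (b * d)"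
    using prime_int_p by (auto simp: prime_dvd_mult_iff add_frac_eq)
  then show ?thesis
    unfolding integral_def by blast
qed

lemma integral_mult:
  assumes "integral x" "integral y"
  shows "integral (x * y)"
proof -
  obtain a b c d where "\<not> int p dvd b" "x = of_int a / of_int b"
    and "\<not> int p dvd d" "y = of_int c / of_int d"
    using assms unfolding integral_def by blast
  then have "\<not> int p dvd b * d" "x * y = of_int (a * c) / of_int (b * d)"
    using prime_int_p by (auto simp: prime_dvd_mult_iff)
  then show ?thesis
    unfolding integral_def by blast
qed

lemma integral_uminus: "integral x \<Longrightarrow> integral (- x)"
  using integral_mult[of "of_int (-1)" x] integral_of_int[of "-1"] by simp

lemma integral_diff: "integral x \<Longrightarrow> integral y \<Longrightarrow> integral (x - y)"
  using integral_add[of x "- y"] integral_uminus by simp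

lemma integral_power: "integral x \<Longrightarrow> integral (x ^ n)"
  by (induction n) (auto intro: integral_mult)

lemma integral_sum: "(\<And>i. i \<in> A \<Longrightarrow> integral (f i)) \<Longrightarrow> integral (sum f A)"
  by (induction A rule: infinite_finite_induct) (auto intro: integral_add)

lemma integral_inverse:
  assumes "\<not> p dvd k"
  shows "integral (1 / of_nat k)"
  using integral_divide_int[of "int k" 1] assms by simp

lemma not_dvd_below: "1 \<le> k \<Longrightarrow> k \<le> p - 1 \<Longrightarrow> \<not> p dvd k"
  by (auto dest!: dvd_imp_le)

lemmas integral_intros =
  integral_add integral_mult integral_uminus integral_diff integral_power integral_sum
  integral_inverse

text \<open>The bridge to \<open>rat_cong_sq\<close>. Comparing a/b with the reduced n/d gives n b =
  a d; a factor p of d would then divide n, as p does not divide b, against coprimality.\<close>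

lemma integral_imp_denominator:
  assumes "integral x"
  shows "\<not> int p dvd snd (quotient_of x)"
proof
  assume dvd: "int p dvd snd (quotient_of x)"
  obtain a b where ab: "\<not> int p dvd b" "x = of_int a / of_int b"
    using assms unfolding integral_def by blast
  obtain n d where nd: "quotient_of x = (n, d)"
    by (cases "quotient_of x")
  then have x: "x = of_int n / of_int d" and d: "d > 0" and "coprime n d"
    using quotient_of_div quotient_of_denom_pos quotient_of_coprime by blast+
  have "b \<noteq> 0"
    using ab by auto
  then have "(of_int (n * b) :: rat) = of_int (a * d)"
    using x ab(2) d by (simp add: field_simps)
  then have "n * b = a * d"
    by (simp only: of_int_eq_iff)
  moreover have "int p dvd d"
    using dvd nd by simp
  ultimately have "int p dvd n"
    using ab(1) prime_int_p by (metis dvd_mult prime_dvd_mult_iff)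
  with \<open>int p dvd d\<close> \<open>coprime n d\<close> show False
    using prime_int_p by (meson coprime_common_divisor not_prime_unit)
qed

lemma rcong_refl [simp]: "rcong n x x"
  unfolding rcong_def by (auto intro!: exI[of _ 0])

lemma rcong_sym: "rcong n x y \<Longrightarrow> rcong n y x"
  unfolding rcong_def
  by (metis integral_uminus minus_diff_eq mult_minus_right)

lemma rcong_add:
  assumes "rcong n x y" "rcong n x' y'"
  shows "rcong n (x + x') (y + y')"
proof -
  obtain z z' where "integral z" "x - y = of_nat p ^ n * z"
    and "integral z'" "x' - y' = of_nat p ^ n * z'"
    using assms unfolding rcong_def by blast
  then have "integral (z + z')" "x + x' - (y + y') = of_nat p ^ n * (z + z')"
    by (auto intro: integral_add simp: algebra_simps)
  then show ?thesis
    unfolding rcong_def by blast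
qed

lemma rcong_trans [trans]:
  assumes "rcong n x y" "rcong n y z"
  shows "rcong n x z"
  \<comment> \<open>The sum of the hypotheses compares \<open>x + y\<close> with
    \<open>y + z\<close>, whose difference is \<open>x - z\<close>.\<close>
  using rcong_add[OF assms] unfolding rcong_def by (simp add: algebra_simps)

lemma rcong_mult_left:
  assumes "rcong n x y" "integral c"
  shows "rcong n (c * x) (c * y)"
proof -
  obtain z where "integral z" "x - y = of_nat p ^ n * z"
    using assms(1) unfolding rcong_def by blast
  then have "integral (c * z)" "c * x - c * y = of_nat p ^ n * (c * z)"
    using assms(2) by (auto intro: integral_mult simp: right_diff_distrib[symmetric])
  then show ?thesis
    unfolding rcong_def by blast
qed

text \<open>The intermediate term is \<open>x * y'\<close>, so only \<open>x\<close> and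
  \<open>y'\<close> have to be integral.\<close>

lemma rcong_mult:
  assumes "rcong n x y" "rcong n x' y'" "integral x" "integral y'"
  shows "rcong n (x * x') (y * y')"
  using rcong_trans[OF rcong_mult_left[OF assms(2,3)]] rcong_mult_left[OF assms(1,4)]
  by (simp add: mult.commute)

lemma rcong_uminus: "rcong n x y \<Longrightarrow> rcong n (- x) (- y)"
  using rcong_mult_left[of n x y "of_int (-1)"] integral_of_int[of "-1"] by simp

lemma rcong_diff: "rcong n x y \<Longrightarrow> rcong n x' y' \<Longrightarrow> rcong n (x - x') (y - y')"
  using rcong_add[of n x y "- x'" "- y'"] rcong_uminus by simp

lemma rcong_sum: "(\<And>i. i \<in> A \<Longrightarrow> rcong n (f i) (g i)) \<Longrightarrow> rcong n (sum f A) (sum g A)"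
  by (induction A rule: infinite_finite_induct) (auto intro: rcong_add)

text \<open>Explicit factors p^k raise the modulus: facts known only modulo p are lifted in this way
  to the moduli p^2 and p^3 required later.\<close>

lemma rcong_scale: "rcong n x y \<Longrightarrow> l = n + k \<Longrightarrow> rcong l (of_nat p ^ k * x) (of_nat p ^ k * y)"
  unfolding rcong_def by (auto simp: right_diff_distrib[symmetric] power_add)

lemma rcong_weaken:
  assumes "rcong (n + k) x y"
  shows "rcong n x y"
proof -
  obtain z where "integral z" "x - y = of_nat p ^ n * (of_nat p ^ k * z)"
    using assms unfolding rcong_def by (auto simp: power_add mult.assoc)
  moreover from this have "integral (of_nat p ^ k * z)"
    by (auto intro!: integral_intros)
  ultimately show ?thesis
    unfolding rcong_def by blast
qed

section \<open>Reciprocals modulo p and the sum of their squares\<close>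

lemma rcong_inverse:
  assumes "\<not> p dvd k" "\<not> p dvd l" "int k - int l = int p * c"
  shows "rcong 1 (1 / of_nat k) (1 / of_nat l)"
proof -
  have nz: "(of_nat k :: rat) \<noteq> 0" "(of_nat l :: rat) \<noteq> 0"
    using assms by (auto intro: gr0I)
  have "(of_nat k :: rat) - of_nat l = of_nat p * of_int c"
    using arg_cong[OF assms(3), of "of_int :: int \<Rightarrow> rat"] by simp
  then have "1 / of_nat k - 1 / of_nat l
      = of_nat p ^ 1 * (- of_int c * ((1 / of_nat k) * (1 / of_nat l)) :: rat)"
    using nz by (simp add: field_simps)
  moreover have "integral (- of_int c * ((1 / of_nat k) * (1 / of_nat l)))"
    using assms by (intro integral_intros integral_of_int)
  ultimately show ?thesis
    unfolding rcong_def by blast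
qed

text \<open>The sum 1/k + 1/(p - k) equals p/(k (p - k)).\<close>

lemma rcong_inverse_reflect:
  assumes "1 \<le> k" "k \<le> p - 1"
  shows "rcong 1 (1 / of_nat (p - k)) (- (1 / of_nat k))"
proof -
  have nd: "\<not> p dvd k" "\<not> p dvd (p - k)"
    using assms by (intro not_dvd_below; simp)+
  have "integral (1 / of_nat k * (1 / of_nat (p - k)))"
    using nd by (intro integral_intros)
  moreover have "1 / of_nat (p - k) - (- (1 / of_nat k))
      = of_nat p ^ 1 * (1 / of_nat k * (1 / of_nat (p - k)) :: rat)"
    using assms by (simp add: of_nat_diff field_simps)
  ultimately show ?thesis
    unfolding rcong_def by blast
qed

text \<open>Doubling permutes the nonzero residues, so the sum \<open>S\<close> satisfies \<open>S \<equiv> S / 4\<close>.\<close>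

lemma sum_inverse_squares:
  assumes "p > 3"
  shows "rcong 1 (\<Sum>k\<in>{1..p-1}. (1 / of_nat k)\<^sup>2) 0"
proof -
  define S :: rat where "S = (\<Sum>k\<in>{1..p-1}. (1 / of_nat k)\<^sup>2)"
  have cop2: "coprime 2 p"
    using assms prime_p by (simp add: prime_odd_nat)
  have nd2: "\<not> p dvd 2 * k" if "k \<in> {1..p-1}" for k
    using that cop2 not_dvd_below by (auto simp: coprime_dvd_mult_right_iff coprime_commute)
  have inj: "inj_on (\<lambda>k. (2 * k) mod p) {1..p-1}"
  proof (rule inj_onI)
    fix x y assume xy: "x \<in> {1..p-1}" "y \<in> {1..p-1}" "(2 * x) mod p = (2 * y) mod p"
    then have "[2 * x = 2 * y] (mod p)"
      by (simp add: cong_def)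
    then have "[x = y] (mod p)"
      using cop2 cong_mult_lcancel_nat by blast
    moreover have "x < p" "y < p"
      using xy assms by auto
    ultimately show "x = y"
      by (simp add: cong_def)
  qed
  have sub: "(\<lambda>k. (2 * k) mod p) ` {1..p-1} \<subseteq> {1..p-1}"
  proof safe
    fix k assume k: "k \<in> {1..p-1}"
    have "(2 * k) mod p < p"
      using assms by simp
    moreover have "(2 * k) mod p \<noteq> 0"
      using nd2[OF k] by (simp add: dvd_eq_mod_eq_0)
    ultimately show "(2 * k) mod p \<in> {1..p-1}"
      by auto
  qed
  \<comment> \<open>An injective self-map of a finite set is onto.\<close>
  have img: "(\<lambda>k. (2 * k) mod p) ` {1..p-1} = {1..p-1}"
    using endo_inj_surj[OF _ sub inj] by simp
  have "S = (\<Sum>k\<in>(\<lambda>k. (2 * k) mod p) ` {1..p-1}. (1 / of_nat k)\<^sup>2)"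
    by (simp only: img S_def)
  also have "\<dots> = (\<Sum>k\<in>{1..p-1}. (1 / of_nat ((2 * k) mod p))\<^sup>2)"
    by (subst sum.reindex[OF inj]) simp
  finally have S1: "S = (\<Sum>k\<in>{1..p-1}. (1 / of_nat ((2 * k) mod p))\<^sup>2)" .
  have "rcong 1 S (\<Sum>k\<in>{1..p-1}. (1 / of_nat (2 * k))\<^sup>2)"
    unfolding S1
  proof (rule rcong_sum)
    fix k assume k: "k \<in> {1..p-1}"
    have nd: "\<not> p dvd (2 * k) mod p" "\<not> p dvd 2 * k"
      using nd2[OF k] by (auto simp: dvd_mod_iff)
    have "2 * k = p * (2 * k div p) + (2 * k) mod p"
      by simp
    then have "int (2 * k) = int p * int (2 * k div p) + int ((2 * k) mod p)"
      by (metis of_nat_add of_nat_mult)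
    then have "int ((2 * k) mod p) - int (2 * k) = int p * (- int (2 * k div p))"
      by simp
    from rcong_inverse[OF nd this]
    show "rcong 1 ((1 / of_nat ((2 * k) mod p))\<^sup>2) ((1 / of_nat (2 * k))\<^sup>2)"
      unfolding power2_eq_square using nd by (intro rcong_mult integral_inverse)
  qed
  also have "(\<Sum>k\<in>{1..p-1}. (1 / of_nat (2 * k))\<^sup>2) = S / 4"
    by (simp add: S_def sum_divide_distrib power_mult_distrib field_simps)
  finally have "rcong 1 S (S / 4)" .
  \<comment> \<open>Since S - S/4 = 3S/4, multiplying by 4/3 recovers S; p > 3 makes 4/3
    integral.\<close>
  moreover have "\<not> int p dvd 3"
    using assms zdvd_imp_le by fastforce
  then have "integral (4 / 3)"
    using integral_divide_int[of 3 4] by simp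
  ultimately have "rcong 1 (4 / 3 * S - 4 / 3 * (S / 4)) 0"
    using rcong_diff[OF rcong_mult_left[of 1 S "S / 4" "4 / 3"] rcong_refl[of 1 "4 / 3 * (S / 4)"]]
    by simp
  then show ?thesis
    by (simp add: S_def algebra_simps)
qed

section \<open>Binomial coefficients modulo p^2 and p^3\<close>

text \<open>With N = cp, the signed coefficient is the product of the factors 1 - N/j for j = 1,
  ..., k, and products of two or more N/j vanish modulo p^2. Wolstenholme's congruence uses c = 1,
  the sum T uses c = 2.\<close>

lemma signed_binomial_cong:
  assumes "c \<ge> 1" "k < p"
  shows "rcong 2 ((-1) ^ k * of_nat ((c * p - 1) choose k))
    (1 - of_nat (c * p) * (\<Sum>j\<in>{1..k}. 1 / of_nat j))"
  using assms(2)
proof (induction k)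
  case 0
  then show ?case by simp
next
  case (Suc k)
  let ?H = "\<lambda>k. \<Sum>j\<in>{1..k}. 1 / of_nat j :: rat"
  let ?N = "of_nat (c * p) :: rat"
  let ?i = "1 / of_nat (Suc k) :: rat"
  have le: "p \<le> c * p"
    using assms by simp
  have nd: "\<not> p dvd Suc k"
    using Suc.prems by (auto dest: dvd_imp_le)
  have "k < c * p" using Suc.prems le by linarith
  have "Suc k * ((c * p - 1) choose Suc k) = (c * p - 1 - k) * ((c * p - 1) choose k)"
    by (metis binomial_absorb_comp binomial_absorption)
  then have "(of_nat (Suc k) :: rat) * of_nat ((c * p - 1) choose Suc k)
      = of_nat (c * p - Suc k) * of_nat ((c * p - 1) choose k)"
    by (metis of_nat_mult diff_diff_left plus_1_eq_Suc)
  also have "(of_nat (c * p - Suc k) :: rat) = ?N - of_nat (Suc k)"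
    using \<open>k < c * p\<close> by (simp add: of_nat_diff)
  finally have "(of_nat ((c * p - 1) choose Suc k) :: rat)
      = (?N * ?i - 1) * of_nat ((c * p - 1) choose k)"
    by (simp add: field_simps del: of_nat_Suc)
  then have eq: "(-1) ^ Suc k * of_nat ((c * p - 1) choose Suc k)
      = (1 - ?N * ?i) * ((-1) ^ k * of_nat ((c * p - 1) choose k))"
    by (simp only: power_Suc) (simp add: algebra_simps del: of_nat_Suc)
  have "rcong 2 ((-1) ^ Suc k * of_nat ((c * p - 1) choose Suc k)) ((1 - ?N * ?i) * (1 - ?N * ?H k))"
    unfolding eq using Suc nd by (intro rcong_mult_left integral_intros integral_of_nat) auto
  \<comment> \<open>With N = cp and h(k) the harmonic number, the two sides differ by N^2 h(k)/(k +
    1), and N^2 carries p^2.\<close>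
  also have "rcong 2 ((1 - ?N * ?i) * (1 - ?N * ?H k)) (1 - ?N * ?H (Suc k))"
  proof -
    have "integral (1 / of_nat j)" if "j \<in> {1..k}" for j
      using that Suc.prems by (intro integral_inverse not_dvd_below) auto
    then have "integral (of_nat c * of_nat c * ?i * ?H k)"
      using integral_inverse[OF nd] by (intro integral_mult integral_of_nat integral_sum) auto
    moreover have "(1 - ?N * ?i) * (1 - ?N * ?H k) - (1 - ?N * ?H (Suc k))
        = of_nat p ^ 2 * (of_nat c * of_nat c * ?i * ?H k)"
      by (simp add: algebra_simps power2_eq_square del: of_nat_Suc)
    ultimately show ?thesis
      unfolding rcong_def by blast
  qed
  finally show ?case .
qed

text \<open>By Vandermonde the central coefficient is the sum of C(p, k)^2. The end terms give 2;
  the others are (p/k)^2 C(p - 1, k - 1)^2, that is p^2/k^2 modulo p^3, and the sum of 1/k^2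
  vanishes modulo p.\<close>

lemma wolstenholme_binomial:
  assumes "p > 3"
  shows "rcong 3 (of_nat ((2 * p) choose p)) 2"
proof -
  have split: "{..p} = insert 0 (insert p {1..p-1})"
    using assms by auto
  have "of_nat ((2 * p) choose p) = (\<Sum>k\<le>p. (of_nat (p choose k) :: rat)\<^sup>2)"
    by (simp flip: choose_square_sum)
  also have "\<dots> = 2 + (\<Sum>k\<in>{1..p-1}. (of_nat (p choose k))\<^sup>2)"
    unfolding split using assms by simp
  also have "rcong 3 \<dots> (2 + (\<Sum>k\<in>{1..p-1}. of_nat p ^ 2 * (1 / of_nat k)\<^sup>2))"
  proof (intro rcong_add rcong_sum rcong_refl)
    fix k assume k: "k \<in> {1..p-1}"
    \<comment> \<open>The sign makes \<open>signed_binomial_cong\<close> applicable and disappears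
      on squaring.\<close>
    define s :: rat where "s = (-1) ^ (k - 1) * of_nat ((p - 1) choose (k - 1))"
    have "k * (p choose k) = p * ((p - 1) choose (k - 1))"
      using binomial_absorption[of "k - 1" p] k by (simp del: mult_Suc)
    then have "(of_nat k :: rat) * of_nat (p choose k) = of_nat p * of_nat ((p - 1) choose (k - 1))"
      by (metis of_nat_mult)
    then have "of_nat (p choose k)
        = of_nat p * (1 / of_nat k) * (of_nat ((p - 1) choose (k - 1)) :: rat)"
      using k by (simp add: field_simps)
    moreover have "s\<^sup>2 = (of_nat ((p - 1) choose (k - 1)))\<^sup>2"
      by (simp add: s_def power_mult_distrib flip: power_mult)
    ultimately have sq: "(of_nat (p choose k))\<^sup>2 = of_nat p ^ 2 * ((1 / of_nat k)\<^sup>2 * s\<^sup>2)"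
      by (simp add: power_mult_distrib power_divide)
    have ints: "integral s"
      unfolding s_def using integral_of_int[of "-1"] by (auto intro!: integral_intros)
    have nd: "\<not> p dvd k"
      using k by (intro not_dvd_below) auto
    have harm: "integral (\<Sum>j\<in>{1..k-1}. 1 / of_nat j)"
      using k by (intro integral_intros not_dvd_below) auto
    have "k - 1 < p"
      using k assms by auto
    \<comment> \<open>The modulus is written \<open>1 + 1\<close> to fit
      \<open>rcong_weaken\<close>. Modulo p suffices, since p^2 is already factored out of the
      squared coefficient.\<close>
    then have "rcong (1 + 1) s (1 - of_nat p * (\<Sum>j\<in>{1..k-1}. 1 / of_nat j))"
      using signed_binomial_cong[of 1 "k - 1"] by (simp only: s_def mult_1 le_refl one_add_one)
    then have "rcong 1 s (1 - of_nat p * (\<Sum>j\<in>{1..k-1}. 1 / of_nat j))"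
      by (rule rcong_weaken)
    also have "rcong 1 \<dots> 1"
      using integral_uminus[OF harm] unfolding rcong_def by (intro exI conjI, assumption) simp
    finally have "rcong 1 (s * s) (1 * 1)"
      using ints by (intro rcong_mult) auto
    then have "rcong 1 ((1 / of_nat k)\<^sup>2 * s\<^sup>2) ((1 / of_nat k)\<^sup>2 * 1)"
      using nd by (intro rcong_mult_left integral_intros) (auto simp: power2_eq_square)
    from rcong_scale[OF this, of 3 2]
    show "rcong 3 ((of_nat (p choose k))\<^sup>2) (of_nat p ^ 2 * (1 / of_nat k)\<^sup>2)"
      unfolding sq by simp
  qed
  also have "rcong 3 \<dots> (2 + of_nat p ^ 2 * 0)"
    using rcong_scale[OF sum_inverse_squares[OF assms], of 3 2]
    by (intro rcong_add rcong_refl) (simp add: sum_distrib_left)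
  finally show ?thesis by simp
qed

end

section \<open>Sums of 1/(j k) over pairs of indices\<close>

text \<open>The residue condition depends only on s = j + k, so pairs are grouped by s. In each
  group 1/(j k) = (1/j + 1/k)/s, and both halves sum to the same harmonic number by j -> s -
  j.\<close>

lemma sum_inverse_products_below:
  fixes m p :: nat and c :: int
  shows "(\<Sum>(j, k)\<in>{(j, k). j \<in> {1..p-1} \<and> k \<in> {1..p-1} \<and> [int (j + k) = c] (mod int m) \<and> j + k < p}.
      1 / of_nat j * (1 / of_nat k) :: rat)
    = 2 * (\<Sum>s\<in>{s. 1 \<le> s \<and> s \<le> p - 1 \<and> [int s = c] (mod int m)}.
        1 / of_nat s * (\<Sum>j\<in>{1..s-1}. 1 / of_nat j))"
    (is "sum _ ?D = 2 * sum _ ?A")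
proof -
  have "(\<Sum>(j, k)\<in>?D. 1 / of_nat j * (1 / of_nat k) :: rat)
      = (\<Sum>(s, j)\<in>(SIGMA s:?A. {1..s-1}). 1 / of_nat j * (1 / of_nat (s - j)))"
    by (rule sum.reindex_bij_witness[where i = "\<lambda>(s, j). (j, s - j)" and j = "\<lambda>(j, k). (j + k, j)"])
      auto
  also have "\<dots> = (\<Sum>s\<in>?A. \<Sum>j\<in>{1..s-1}. 1 / of_nat j * (1 / of_nat (s - j)))"
    by (rule sum.Sigma[symmetric]) auto
  also have "\<dots> = (\<Sum>s\<in>?A. 2 * (1 / of_nat s * (\<Sum>j\<in>{1..s-1}. 1 / of_nat j)))"
  proof (rule sum.cong[OF refl])
    fix s assume s: "s \<in> ?A"
    have "(\<Sum>j\<in>{1..s-1}. 1 / of_nat j * (1 / of_nat (s - j)) :: rat)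
        = (\<Sum>j\<in>{1..s-1}. 1 / of_nat s * (1 / of_nat j + 1 / of_nat (s - j)))"
    proof (rule sum.cong[OF refl])
      fix j assume j: "j \<in> {1..s-1}"
      then have "j \<le> s"
        unfolding atLeastAtMost_iff by arith
      then have "(of_nat s :: rat) = of_nat j + of_nat (s - j)"
        by (simp add: of_nat_diff)
      moreover have "(of_nat j :: rat) > 0" "(of_nat (s - j) :: rat) > 0"
        using j by auto
      ultimately show "1 / of_nat j * (1 / of_nat (s - j))
          = 1 / of_nat s * (1 / of_nat j + 1 / of_nat (s - j) :: rat)"
        by (simp add: divide_simps)
    qed
    also have "\<dots> = 1 / of_nat s
        * ((\<Sum>j\<in>{1..s-1}. 1 / of_nat j) + (\<Sum>j\<in>{1..s-1}. 1 / of_nat (s - j)))"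
      by (simp only: sum_distrib_left[symmetric] sum.distrib)
    also have "(\<Sum>j\<in>{1..s-1}. 1 / of_nat (s - j) :: rat) = (\<Sum>j\<in>{1..s-1}. 1 / of_nat j)"
      by (rule sum.reindex_bij_witness[where i = "\<lambda>j. s - j" and j = "\<lambda>j. s - j"]) auto
    finally show "(\<Sum>j\<in>{1..s-1}. 1 / of_nat j * (1 / of_nat (s - j)) :: rat)
        = 2 * (1 / of_nat s * (\<Sum>j\<in>{1..s-1}. 1 / of_nat j))"
      by simp
  qed
  finally show ?thesis
    by (simp add: sum_distrib_left)
qed

text \<open>Each square expands over pairs from one class, and these blocks partition the pairs with
  j \<equiv> k because 1, ..., m represent every residue class exactly once.\<close>

lemma sum_H_res_squares:
  assumes "m \<ge> 1"
  shows "(\<Sum>r\<in>{1..int m}. (H_res r m n)\<^sup>2)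
    = (\<Sum>(j, k)\<in>{(j, k). j \<in> {1..n} \<and> k \<in> {1..n} \<and> [int j = int k] (mod int m)}.
        1 / of_nat j * (1 / of_nat k))"
proof -
  define A where "A r = {k. 1 \<le> k \<and> k \<le> n \<and> [int k = r] (mod int m)}" for r
  have fin: "finite (A r)" for r
    by (rule finite_subset[of _ "{1..n}"]) (auto simp: A_def)
  have rep: "\<exists>r\<in>{1..int m}. [int j = r] (mod int m)" for j
  proof (cases "int j mod int m = 0")
    case True
    \<comment> \<open>The range starts at 1, so the zero class is represented by m.\<close>
    with assms show ?thesis
      by (intro bexI[of _ "int m"]) (auto simp: cong_def)
  next
    case False
    moreover have "int j mod int m \<ge> 0" "int j mod int m < int m"
      using assms by auto
    ultimately show ?thesis
      by (intro bexI[of _ "int j mod int m"]) (auto simp: cong_def)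
  qed
  have uniq: "r = s" if "r \<in> {1..int m}" "s \<in> {1..int m}" "[r = s] (mod int m)" for r s
  proof -
    \<comment> \<open>Two elements of the range differ by less than m, so a difference divisible by
      m is 0.\<close>
    have "int m dvd r - s" "\<bar>r - s\<bar> < int m"
      using that by (auto simp: cong_iff_dvd_diff)
    then show ?thesis
      using zdvd_imp_le by (metis abs_of_nonneg diff_ge_0_iff_ge dvd_abs_iff
          abs_ge_zero zero_less_abs_iff eq_iff_diff_eq_0 not_less)
  qed
  have disj: "r = s" if "r \<in> {1..int m}" "s \<in> {1..int m}" "k \<in> A r" "k \<in> A s" for r s k
  proof -
    have "[int k = r] (mod int m)" "[int k = s] (mod int m)"
      using that by (auto simp: A_def)
    then have "[r = s] (mod int m)"
      by (metis cong_sym cong_trans)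
    with that show ?thesis
      by (intro uniq)
  qed
  have "(\<Sum>r\<in>{1..int m}. (H_res r m n)\<^sup>2)
      = (\<Sum>r\<in>{1..int m}. \<Sum>(j, k)\<in>A r \<times> A r. 1 / of_nat j * (1 / of_nat k))"
    by (simp only: H_res_def A_def[symmetric] power2_eq_square sum_product sum.cartesian_product)
  also have "\<dots> = (\<Sum>(j, k)\<in>(\<Union>r\<in>{1..int m}. A r \<times> A r). 1 / of_nat j * (1 / of_nat k))"
  proof (rule sum.UNION_disjoint[symmetric])
    show "\<forall>r\<in>{1..int m}. \<forall>s\<in>{1..int m}. r \<noteq> s \<longrightarrow> (A r \<times> A r) \<inter> (A s \<times> A s) = {}"
      using disj by blast
  qed (auto simp: fin)
  also have "(\<Union>r\<in>{1..int m}. A r \<times> A r)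
      = {(j, k). j \<in> {1..n} \<and> k \<in> {1..n} \<and> [int j = int k] (mod int m)}"
  proof -
    have "\<exists>r\<in>{1..int m}. j \<in> A r \<and> k \<in> A r"
      if jk: "j \<in> {1..n}" "k \<in> {1..n}" "[int j = int k] (mod int m)" for j k
    proof -
      obtain r where "r \<in> {1..int m}" "[int j = r] (mod int m)"
        using rep by blast
      moreover from this have "[int k = r] (mod int m)"
        using jk(3) by (metis cong_sym cong_trans)
      ultimately show ?thesis
        using jk by (auto simp: A_def)
    qed
    then show ?thesis
      by (auto simp: A_def intro: cong_trans cong_sym)
  qed
  finally show ?thesis .
qed

lemma cong_diff_left_iff: "[a - x = b] (mod m) \<longleftrightarrow> [x = a - b] (mod m)" for a x b m :: int
proof -
  have "a - x - b = - (x - (a - b))"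
    by simp
  then show ?thesis
    by (simp only: cong_iff_dvd_diff dvd_minus_iff)
qed

context prime_modulus
begin

text \<open>Split by comparing j + k with p. The lower part is exactly half the target, the upper
  part reflects onto it modulo p, and the part j + k = p reduces to minus the sum of 1/j^2.\<close>

lemma sum_inverse_products:
  fixes m :: nat
  assumes "p > 3"
  shows "rcong 1
    (\<Sum>(j, k)\<in>{(j, k). j \<in> {1..p-1} \<and> k \<in> {1..p-1} \<and> [int (j + k) = int p] (mod int m)}.
      1 / of_nat j * (1 / of_nat k))
    (4 * (\<Sum>s\<in>{s. 1 \<le> s \<and> s \<le> p - 1 \<and> [int s = int p] (mod int m)}.
        1 / of_nat s * (\<Sum>j\<in>{1..s-1}. 1 / of_nat j)))"
    (is "rcong 1 (sum ?f ?D) (4 * ?E)")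
proof -
  define L where "L = {(j, k). j \<in> {1..p-1} \<and> k \<in> {1..p-1} \<and> [int (j + k) = int p] (mod int m) \<and> j + k < p}"
  define G where "G = {(j, k). j \<in> {1..p-1} \<and> k \<in> {1..p-1} \<and> [int (j + k) = int p] (mod int m) \<and> j + k > p}"
  define M where "M = {(j, k). j \<in> {1..p-1} \<and> k \<in> {1..p-1} \<and> j + k = p}"
  have D: "?D = L \<union> (G \<union> M)"
    by (auto simp: L_def G_def M_def)
  have fin: "finite L" "finite G" "finite M"
    by (rule finite_subset[of _ "{1..p-1} \<times> {1..p-1}"]; auto simp: L_def G_def M_def)+
  have disj: "L \<inter> (G \<union> M) = {}" "G \<inter> M = {}"
    by (auto simp: L_def G_def M_def)
  have split: "sum ?f ?D = sum ?f L + (sum ?f G + sum ?f M)"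
    unfolding D using fin disj by (simp add: sum.union_disjoint)
  have L: "sum ?f L = 2 * ?E"
    unfolding L_def by (rule sum_inverse_products_below)
  \<comment> \<open>Reflecting both entries replaces j + k by 2p - (j + k), which swaps
    \<open>G\<close> and \<open>L\<close> and preserves the class of p. The two signs arising modulo
    p cancel.\<close>
  have "sum ?f G = (\<Sum>(j, k)\<in>L. 1 / of_nat (p - j) * (1 / of_nat (p - k)))"
  proof (rule sum.reindex_bij_witness[where i = "\<lambda>(j, k). (p - j, p - k)" and j = "\<lambda>(j, k). (p - j, p - k)"])
    have reflect: "[int (p - j + (p - k)) = int p] (mod int m) \<longleftrightarrow> [int (j + k) = int p] (mod int m)"
      if "j \<le> p" "k \<le> p" for j k
    proof -
      have "int (p - j + (p - k)) = 2 * int p - int (j + k)"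
        using that by simp
      then show ?thesis
        by (simp only: cong_diff_left_iff) simp
    qed
    show "(case a of (j, k) \<Rightarrow> (p - j, p - k)) \<in> L" if "a \<in> G" for a
      using that reflect by (cases a) (auto simp: L_def G_def simp del: of_nat_add of_nat_diff)
    show "(case a of (j, k) \<Rightarrow> (p - j, p - k)) \<in> G" if "a \<in> L" for a
      using that reflect by (cases a) (auto simp: L_def G_def add.commute simp del: of_nat_add of_nat_diff)
  qed (auto simp: L_def G_def)
  also have "rcong 1 \<dots> (\<Sum>(j, k)\<in>L. (- (1 / of_nat j)) * (- (1 / of_nat k)))"
  proof (rule rcong_sum, clarify)
    fix j k assume "(j, k) \<in> L"
    then have jk: "1 \<le> j" "j \<le> p - 1" "1 \<le> k" "k \<le> p - 1"
      by (auto simp: L_def)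
    show "rcong 1 (1 / of_nat (p - j) * (1 / of_nat (p - k))) ((- (1 / of_nat j)) * (- (1 / of_nat k)))"
      using jk by (intro rcong_mult rcong_inverse_reflect integral_uminus integral_inverse not_dvd_below) auto
  qed
  finally have G: "rcong 1 (sum ?f G) (2 * ?E)"
    using L by simp
  \<comment> \<open>On \<open>M\<close> the second entry is p - j, so each term is -1/j^2 modulo
    p.\<close>
  have "sum ?f M = (\<Sum>j\<in>{1..p-1}. 1 / of_nat j * (1 / of_nat (p - j)))"
    by (rule sum.reindex_bij_witness[where i = "\<lambda>j. (j, p - j)" and j = fst]) (auto simp: M_def)
  also have "rcong 1 \<dots> (\<Sum>j\<in>{1..p-1}. 1 / of_nat j * (- (1 / of_nat j)))"
    by (intro rcong_sum rcong_mult_left rcong_inverse_reflect integral_inverse not_dvd_below) auto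
  also have "\<dots> = - (\<Sum>j\<in>{1..p-1}. (1 / of_nat j)\<^sup>2)"
    by (simp add: sum_negf power2_eq_square)
  also have "rcong 1 \<dots> (- 0)"
    by (intro rcong_uminus sum_inverse_squares assms)
  finally have M: "rcong 1 (sum ?f M) 0"
    by simp
  show ?thesis
    unfolding split L using rcong_add[OF rcong_refl[of 1 "2 * ?E"] rcong_add[OF G M]] by simp
qed

text \<open>Replacing j by p - j turns j \<equiv> k into j + k \<equiv> p at the price of one sign
  modulo p, whence -4 in place of the 4 of \<open>sum_inverse_products\<close>.\<close>

lemma sum_H_res_squares_cong:
  assumes "p > 3" "m \<ge> 1"
  shows "rcong 1 (\<Sum>r\<in>{1..int m}. (H_res r m (p - 1))\<^sup>2)
    (- 4 * (\<Sum>s\<in>{s. 1 \<le> s \<and> s \<le> p - 1 \<and> [int s = int p] (mod int m)}.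
        1 / of_nat s * (\<Sum>j\<in>{1..s-1}. 1 / of_nat j)))"
    (is "rcong 1 _ (- 4 * ?E)")
proof -
  let ?D = "{(j, k). j \<in> {1..p-1} \<and> k \<in> {1..p-1} \<and> [int (j + k) = int p] (mod int m)}"
  have "(\<Sum>r\<in>{1..int m}. (H_res r m (p - 1))\<^sup>2)
      = (\<Sum>(j, k)\<in>{(j, k). j \<in> {1..p-1} \<and> k \<in> {1..p-1} \<and> [int j = int k] (mod int m)}.
          1 / of_nat j * (1 / of_nat k))"
    by (rule sum_H_res_squares[OF assms(2)])
  \<comment> \<open>This reindexing is exact; the sign enters only when 1/(p - j) is reduced modulo
    p.\<close>
  also have "\<dots> = (\<Sum>(j, k)\<in>?D. 1 / of_nat (p - j) * (1 / of_nat k))"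
  proof (rule sum.reindex_bij_witness[where i = "\<lambda>(j, k). (p - j, k)" and j = "\<lambda>(j, k). (p - j, k)"])
    have reflect1: "[int (p - j + k) = int p] (mod int m) \<longleftrightarrow> [int j = int k] (mod int m)" if "j \<le> p" for j k
    proof -
      have "int (p - j + k) - int p = - (int j - int k)"
        using that by (simp add: of_nat_diff)
      then show ?thesis
        by (simp only: cong_iff_dvd_diff dvd_minus_iff)
    qed
    have reflect2: "[int (p - j) = int k] (mod int m) \<longleftrightarrow> [int (j + k) = int p] (mod int m)" if "j \<le> p" for j k
    proof -
      have "int (p - j) - int k = - (int (j + k) - int p)"
        using that by (simp add: of_nat_diff)
      then show ?thesis
        by (simp only: cong_iff_dvd_diff dvd_minus_iff)
    qed
    show "(case a of (j, k) \<Rightarrow> (p - j, k)) \<in> ?D"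
      if "a \<in> {(j, k). j \<in> {1..p-1} \<and> k \<in> {1..p-1} \<and> [int j = int k] (mod int m)}" for a
      using that reflect1 reflect2 by (cases a) (auto simp del: of_nat_add of_nat_diff)
    show "(case a of (j, k) \<Rightarrow> (p - j, k))
          \<in> {(j, k). j \<in> {1..p-1} \<and> k \<in> {1..p-1} \<and> [int j = int k] (mod int m)}"
      if "a \<in> ?D" for a
      using that reflect1 reflect2 by (cases a) (auto simp del: of_nat_add of_nat_diff)
  qed auto
  finally have squares: "(\<Sum>r\<in>{1..int m}. (H_res r m (p - 1))\<^sup>2)
      = (\<Sum>(j, k)\<in>?D. 1 / of_nat (p - j) * (1 / of_nat k))" .
  have "rcong 1 (\<Sum>(j, k)\<in>?D. 1 / of_nat (p - j) * (1 / of_nat k))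
      (\<Sum>(j, k)\<in>?D. (- (1 / of_nat j)) * (1 / of_nat k))"
  proof (rule rcong_sum, clarify)
    fix j k assume jk: "j \<in> {1..p-1}" "k \<in> {1..p-1}"
    show "rcong 1 (1 / of_nat (p - j) * (1 / of_nat k)) (- (1 / of_nat j) * (1 / of_nat k))"
      using jk by (intro rcong_mult rcong_inverse_reflect rcong_refl integral_inverse not_dvd_below) auto
  qed
  moreover have "(\<Sum>(j, k)\<in>?D. (- (1 / of_nat j)) * (1 / of_nat k))
      = - (\<Sum>(j, k)\<in>?D. 1 / of_nat j * (1 / of_nat k) :: rat)"
    unfolding sum_negf[symmetric] by (rule sum.cong) auto
  moreover have "rcong 1 (- (\<Sum>(j, k)\<in>?D. 1 / of_nat j * (1 / of_nat k))) (- (4 * ?E))"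
    by (intro rcong_uminus sum_inverse_products assms)
  ultimately have "rcong 1 (\<Sum>(j, k)\<in>?D. 1 / of_nat (p - j) * (1 / of_nat k)) (- (4 * ?E))"
    by (simp only: rcong_trans)
  then show ?thesis
    unfolding squares by (simp only: minus_mult_left)
qed

section \<open>The self-reflected classes, the folded binomial sum and the final congruence\<close>

lemma integral_half:
  assumes "p > 3"
  shows "integral (1 / 2)" "integral (1 / 4)"
proof -
  have "\<not> p dvd 2"
    using assms by (auto dest: dvd_imp_le)
  moreover have "\<not> p dvd 2 * 2"
    using calculation prime_p by (simp only: prime_dvd_mult_iff) simp
  ultimately show "integral (1 / 2)" "integral (1 / 4)"
    using integral_inverse[of 2] integral_inverse[of 4] by simp_all
qed

text \<open>Reflection k -> p - k preserves this class, since p - r \<equiv> r, and negates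
  reciprocals modulo p. Hence H \<equiv> -H, and 2 is invertible.\<close>

lemma H_res_half_class:
  assumes "p > 3" "[2 * r = int p] (mod int m)"
  shows "rcong 1 (H_res r m (p - 1)) 0"
proof -
  let ?A = "{k. 1 \<le> k \<and> k \<le> p - 1 \<and> [int k = r] (mod int m)}"
  have "H_res r m (p - 1) = (\<Sum>k\<in>?A. 1 / of_nat (p - k))"
    unfolding H_res_def
  proof (rule sum.reindex_bij_witness[where i = "\<lambda>k. p - k" and j = "\<lambda>k. p - k"])
    show "p - k \<in> ?A" if "k \<in> ?A" for k
    proof -
      have "[int p - int k = 2 * r - r] (mod int m)"
        using that assms(2) by (intro cong_diff) (auto intro: cong_sym)
      then show ?thesis
        using that by (auto simp: of_nat_diff)
    qed
    then show "p - k \<in> ?A" if "k \<in> ?A" for k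
      using that by blast
  qed auto
  also have "rcong 1 \<dots> (\<Sum>k\<in>?A. - (1 / of_nat k))"
    by (intro rcong_sum rcong_inverse_reflect) auto
  also have "\<dots> = - H_res r m (p - 1)"
    by (simp add: H_res_def sum_negf)
  finally have "rcong 1 (H_res r m (p - 1)) (- H_res r m (p - 1))" .
  from rcong_mult_left[OF rcong_add[OF this rcong_refl[of 1 "H_res r m (p - 1)"]] integral_half(1)[OF assms(1)]]
  show ?thesis by simp
qed

text \<open>The map k -> 2p - k preserves both the class of p and the signed coefficient, so the
  indices pair off around the fixed point p, whose sign is negative because p is odd.\<close>

lemma T_star_double:
  assumes "p > 3" "m \<ge> 2" "p \<noteq> m"
  shows "of_int (T_star (int p) m (2 * p)) = - of_nat ((2 * p) choose p)
    + 2 * (\<Sum>k\<in>{k. 1 \<le> k \<and> k \<le> p - 1 \<and> [int k = int p] (mod int m)}.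
        (-1) ^ k * of_nat ((2 * p) choose k) :: rat)"
proof -
  define A where "A = {k. 1 \<le> k \<and> k \<le> p - 1 \<and> [int k = int p] (mod int m)}"
  have fin: "finite A"
    by (rule finite_subset[of _ "{1..p-1}"]) (auto simp: A_def)
  \<comment> \<open>Index 0 or 2p in the class would force m to divide p. With both excluded, every
    index other than p lies in \<open>A\<close> or in its reflection.\<close>
  have "\<not> m dvd p"
    using prime_p assms by (auto simp: prime_nat_iff)
  then have ndvd: "\<not> [int 0 = int p] (mod int m)" "\<not> [int (2 * p) = int p] (mod int m)"
    by (auto simp: cong_iff_dvd_diff)
  have reflect: "[int (2 * p - k) = int p] (mod int m) \<longleftrightarrow> [int k = int p] (mod int m)"
    if "k \<le> 2 * p" for k
    using that cong_diff_left_iff[of "2 * int p" "int k" "int p"] by (simp add: of_nat_diff)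
  have "{k. k \<le> 2 * p \<and> [int k = int p] (mod int m)} \<subseteq> insert p (A \<union> (\<lambda>k. 2 * p - k) ` A)"
  proof
    fix k assume k: "k \<in> {k. k \<le> 2 * p \<and> [int k = int p] (mod int m)}"
    then have "k \<noteq> 0" "k \<noteq> 2 * p"
      using ndvd by (metis (mono_tags, lifting) mem_Collect_eq)+
    have "2 * p - k \<in> A" if "p < k"
    proof -
      have "1 \<le> 2 * p - k" "2 * p - k \<le> p - 1"
        using k that \<open>k \<noteq> 2 * p\<close> by auto
      then show ?thesis
        using k reflect[of k] by (simp add: A_def)
    qed
    then consider "k \<in> A" | "k = p" | "2 * p - k \<in> A" "k = 2 * p - (2 * p - k)"
      using k \<open>k \<noteq> 0\<close> by (cases k p rule: linorder_cases) (auto simp: A_def)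
    then show "k \<in> insert p (A \<union> (\<lambda>k. 2 * p - k) ` A)"
      by cases auto
  qed
  moreover have "insert p (A \<union> (\<lambda>k. 2 * p - k) ` A) \<subseteq> {k. k \<le> 2 * p \<and> [int k = int p] (mod int m)}"
    using reflect by (auto simp: A_def)
  ultimately have set: "{k. k \<le> 2 * p \<and> [int k = int p] (mod int m)}
      = insert p (A \<union> (\<lambda>k. 2 * p - k) ` A)"
    by blast
  let ?f = "\<lambda>k. (-1) ^ k * int ((2 * p) choose k)"
  have "T_star (int p) m (2 * p) = ?f p + (sum ?f A + sum ?f ((\<lambda>k. 2 * p - k) ` A))"
    unfolding T_star_def set using fin assms(1)
    by (subst sum.insert) (auto simp: A_def intro!: sum.union_disjoint)
  also have "sum ?f ((\<lambda>k. 2 * p - k) ` A) = sum ?f A"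
  proof -
    have "inj_on (\<lambda>k. 2 * p - k) A"
      by (rule inj_onI) (auto simp: A_def)
    moreover have "?f (2 * p - k) = ?f k" if "k \<in> A" for k
    proof -
      have "k \<le> 2 * p"
        using that by (auto simp: A_def)
      then have "(2 * p) choose (2 * p - k) = (2 * p) choose k" "even (2 * p - k) = even k"
        using binomial_symmetric[of k "2 * p"] by simp_all
      then show ?thesis
        by (simp add: minus_one_power_iff)
    qed
    ultimately show ?thesis
      by (simp add: sum.reindex)
  qed
  finally have "T_star (int p) m (2 * p) = ?f p + 2 * sum ?f A"
    by simp
  moreover have "odd p"
    using prime_p assms(1) by (simp add: prime_odd_nat)
  ultimately show ?thesis
    by (simp add: A_def)
qed

text \<open>With C = C(2p, p), absorption gives T + 2 = (2 - C) - 4p (sum of c(k)/k) exactly.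
  Division by 4p is harmless for the sum but costs one power of p in C - 2, which is why C is needed
  modulo p^3.\<close>

lemma H_res_cong:
  assumes "p > 3" "m \<ge> 2" "p \<noteq> m"
  shows "rcong 2 (H_res (int p) m (p - 1))
    (- ((of_int (T_star (int p) m (2 * p)) + 2) / (4 * of_nat p))
      - of_nat p / 2 * (\<Sum>r\<in>{r. 1 \<le> r \<and> r \<le> int m \<and> \<not> [2 * r = int p] (mod int m)}.
          (H_res r m (p - 1))\<^sup>2))"
proof -
  define A where "A = {k. 1 \<le> k \<and> k \<le> p - 1 \<and> [int k = int p] (mod int m)}"
  define B where "B = {r. 1 \<le> r \<and> r \<le> int m \<and> \<not> [2 * r = int p] (mod int m)}"
  define h :: "nat \<Rightarrow> rat" where "h k = (\<Sum>j\<in>{1..k}. 1 / of_nat j)" for k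
  define E where "E = (\<Sum>k\<in>A. 1 / of_nat k * h (k - 1))"
  \<comment> \<open>The exponent matches the lower index, as in \<open>signed_binomial_cong\<close>;
    the sign left over is the minus in \<open>summand\<close>.\<close>
  define c :: "nat \<Rightarrow> rat" where "c k = (-1) ^ (k - 1) * of_nat ((2 * p - 1) choose (k - 1))" for k
  define C :: rat where "C = of_nat ((2 * p) choose p)"
  define S where "S = (\<Sum>r\<in>B. (H_res r m (p - 1))\<^sup>2)"

  have H_int: "integral (H_res r m (p - 1))" for r
    unfolding H_res_def by (intro integral_sum integral_inverse not_dvd_below) auto

  have summand: "(-1) ^ k * of_nat ((2 * p) choose k) = - (2 * of_nat p) * (1 / of_nat k * c k)"
    if k: "k \<in> A" for k
  proof -
    obtain l where l: "k = Suc l"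
      using k by (cases k) (auto simp: A_def)
    have "Suc l * ((2 * p) choose Suc l) = 2 * p * ((2 * p - 1) choose l)"
      by (rule binomial_absorption)
    then have "(of_nat (Suc l) :: rat) * of_nat ((2 * p) choose Suc l)
        = 2 * of_nat p * of_nat ((2 * p - 1) choose l)"
      by (metis of_nat_mult of_nat_numeral)
    then show ?thesis
      by (simp add: l c_def field_simps del: of_nat_Suc)
  qed
  have "(\<Sum>k\<in>A. (-1) ^ k * of_nat ((2 * p) choose k))
      = - (2 * of_nat p) * (\<Sum>k\<in>A. 1 / of_nat k * c k)"
    unfolding sum_distrib_left by (rule sum.cong[OF refl]) (rule summand)
  then have "of_int (T_star (int p) m (2 * p)) + 2 = (2 - C) - 4 * of_nat p * (\<Sum>k\<in>A. 1 / of_nat k * c k)"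
    unfolding T_star_double[OF assms] A_def[symmetric] C_def[symmetric]
    by (simp only:)
  then have T: "- ((of_int (T_star (int p) m (2 * p)) + 2) / (4 * of_nat p))
      = (\<Sum>k\<in>A. 1 / of_nat k * c k) + (C - 2) / (4 * of_nat p)"
    using p_nonzero by (simp add: field_simps)

  have "rcong 2 (\<Sum>k\<in>A. 1 / of_nat k * c k)
      (\<Sum>k\<in>A. 1 / of_nat k * (1 - of_nat (2 * p) * h (k - 1)))"
  proof (rule rcong_sum)
    fix k assume k: "k \<in> A"
    have "rcong 2 (c k) (1 - of_nat (2 * p) * h (k - 1))"
      unfolding c_def h_def using k by (intro signed_binomial_cong) (auto simp: A_def)
    then show "rcong 2 (1 / of_nat k * c k) (1 / of_nat k * (1 - of_nat (2 * p) * h (k - 1)))"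
      using k by (intro rcong_mult_left integral_inverse not_dvd_below) (auto simp: A_def)
  qed
  \<comment> \<open>The constant 1 contributes H itself, the rest the correction -2pE that the
    squares have to cancel.\<close>
  also have "\<dots> = H_res (int p) m (p - 1) - 2 * of_nat p * E"
    unfolding H_res_def A_def[symmetric] E_def
    by (simp add: right_diff_distrib sum_subtractf sum_distrib_left mult_ac)
  finally have main: "rcong 2 (\<Sum>k\<in>A. 1 / of_nat k * c k) (H_res (int p) m (p - 1) - 2 * of_nat p * E)" .

  have "rcong 2 ((C - 2) / (4 * of_nat p)) 0"
  proof -
    obtain z where z: "integral z" "C - 2 = of_nat p ^ 3 * z"
      using wolstenholme_binomial[OF assms(1)] unfolding rcong_def C_def by blast
    have "(C - 2) / (4 * of_nat p) - 0 = of_nat p ^ 2 * (1 / 4 * z)"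
      unfolding z(2) using p_nonzero by (simp add: power3_eq_cube power2_eq_square)
    moreover have "integral (1 / 4 * z)"
      using integral_half[OF assms(1)] z(1) by (intro integral_mult)
    ultimately show ?thesis
      unfolding rcong_def by blast
  qed

  moreover have "rcong 1 S (- 4 * E)"
  proof -
    have "rcong 1 S (\<Sum>r\<in>{1..int m}. (H_res r m (p - 1))\<^sup>2)"
    proof -
      \<comment> \<open>Classes outside \<open>B\<close> satisfy 2r \<equiv> p, so their squares
        vanish modulo p and may be added to \<open>S\<close>.\<close>
      have rest: "rcong 1 (\<Sum>r\<in>{1..int m} - B. (H_res r m (p - 1))\<^sup>2) (\<Sum>r\<in>{1..int m} - B. 0 * 0)"
      proof (rule rcong_sum)
        fix r assume "r \<in> {1..int m} - B"
        then have "[2 * r = int p] (mod int m)"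
          by (simp add: B_def)
        then have "rcong 1 (H_res r m (p - 1)) 0"
          by (rule H_res_half_class[OF assms(1)])
        then show "rcong 1 ((H_res r m (p - 1))\<^sup>2) (0 * 0)"
          unfolding power2_eq_square using H_int by (intro rcong_mult integral_0)
      qed
      have "(\<Sum>r\<in>{1..int m}. (H_res r m (p - 1))\<^sup>2)
          = (\<Sum>r\<in>{1..int m} - B. (H_res r m (p - 1))\<^sup>2) + S"
        unfolding S_def by (rule sum.subset_diff) (auto simp: B_def)
      then show ?thesis
        using rcong_sym[OF rcong_add[OF rest rcong_refl[of 1 S]]] by simp
    qed
    also have "rcong 1 \<dots> (- 4 * E)"
      unfolding E_def A_def h_def using assms by (intro sum_H_res_squares_cong) auto
    finally show ?thesis .
  qed
  \<comment> \<open>\<open>S\<close> is known modulo p only; the factor p in front lifts this to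
    p^2.\<close>
  then have "rcong 2 (of_nat p / 2 * S) (- 2 * of_nat p * E)"
    using rcong_scale[OF rcong_mult_left[OF _ integral_half(1)[OF assms(1)]], of 1 S "- 4 * E" 2 1]
    by (simp add: field_simps)
  \<comment> \<open>The two copies of -2pE cancel, leaving H.\<close>
  ultimately have "rcong 2 (- ((of_int (T_star (int p) m (2 * p)) + 2) / (4 * of_nat p)) - of_nat p / 2 * S)
      ((H_res (int p) m (p - 1) - 2 * of_nat p * E + 0) - (- 2 * of_nat p * E))"
    unfolding T using main by (intro rcong_diff rcong_add)
  then show ?thesis
    unfolding S_def B_def by (simp add: rcong_sym)
qed

end

theorem theorem1p2:
  fixes m p :: nat
  assumes "m \<ge> 2" and "prime p" and "p > 3" and "p \<noteq> m"
  shows "rat_cong_sq p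
           (H_res (int p) m (p - 1))
           (- ((of_int (T_star (int p) m (2 * p)) + 2) / (4 * of_nat p))
            - of_nat p / 2 *
              (\<Sum>r \<in> {r. 1 \<le> r \<and> r \<le> int m \<and> \<not> [2 * r = int p] (mod int m)}.
                 (H_res r m (p - 1))\<^sup>2))"
    (is "rat_cong_sq p ?x ?y")
proof -
  interpret prime_modulus p
    by unfold_locales fact
  obtain z where "integral z" "?x - ?y = of_nat p ^ 2 * z"
    using H_res_cong[OF assms(3,1,4)] unfolding rcong_def by blast
  \<comment> \<open>The quotient by p^2 is the integral witness itself, whose reduced denominator is
    prime to p.\<close>
  then have "(?x - ?y) / (of_nat p)\<^sup>2 = z" "\<not> int p dvd snd (quotient_of z)"
    using p_nonzero integral_imp_denominator by simp_all
  then show ?thesis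
    unfolding rat_cong_sq_def by simp
qed

end
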